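(* An invertible linear map $M$ of $\mathbb R^{1+d}$ is frequency-respecting if and only if it has the block form $$M=\begin{pmatrix}p&\boldsymbol q^{\mathrm T}\\0&S\end{pmatrix},\qquad p\neq0,\quad S\in\mathbb R^{d\times d}\text{ invertible},\ \boldsymbol q\in\mathbb R^d,$$ i.e. its spatial rows contain no time component. The pullback $f\mapsto f\circ M^{-1}$ then maps time-harmonic fields of frequency $\omega$ to time-harmonic fields of frequency $\omega/p$. Maps of this block form constitute a group (denoted $G_f$).
   Context: Coordinates on $\mathbb R^{1+d}$ ($d\in\{2,3\}$) are $\xi=(t,\boldsymbol x)$, and block matrices are written with respect to this splitting. A time-harmonic field of frequency $\omega$ is a function of the form $e^{-\mathrm i\omega t}F(\boldsymbol x)$. An invertible linear map $M$ of $\mathbb R^{1+d}$ is frequency-respecting if the pullback $f\mapsto f\circ M^{-1}$ carries every time-harmonic field $e^{-\mathrm i\omega t}F(\boldsymbol x)$ to a time-harmonic field (in the new coordinates $\xi'=M\xi$, of a possibly different common frequency). *)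

theory Defs
  imports "HOL-Analysis.Analysis" "HOL-Algebra.Group"
begin

text \<open>Space-time with \<open>d\<close> space dimensions is \<^typ>\<open>real \<times> (real^'d)\<close>, with \<open>d = CARD('d)\<close>.\<close>

type_synonym 'd spacetime = "real \<times> (real^'d)"

text \<open>No regularity of the spatial profile \<open>F\<close> is required, and the frequency may be any real
  number, including zero and negative ones (negative \<open>p\<close> turns \<open>\<omega> > 0\<close> into \<open>\<omega> / p < 0\<close>).\<close>

definition time_harmonic :: "real \<Rightarrow> ('d::finite spacetime \<Rightarrow> complex) \<Rightarrow> bool" where
  "time_harmonic \<omega> f \<longleftrightarrow>
     (\<exists>F :: real^'d \<Rightarrow> complex. \<forall>t x. f (t, x) = exp (- \<i> * of_real \<omega> * of_real t) * F x)"

text \<open>The inverse map is written \<^term>\<open>inv_into UNIV M\<close> because the notation \<open>inv\<close> is shared with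
  the inverse in a group.\<close>

definition pullback :: "('d::finite spacetime \<Rightarrow> 'd spacetime)
    \<Rightarrow> ('d spacetime \<Rightarrow> complex) \<Rightarrow> ('d spacetime \<Rightarrow> complex)" where
  "pullback M f = f \<circ> inv_into UNIV M"

definition invertible_linear :: "('d::finite spacetime \<Rightarrow> 'd spacetime) \<Rightarrow> bool" where
  "invertible_linear M \<longleftrightarrow> linear M \<and> bij M"

text \<open>The new frequency \<open>\<omega>'\<close> is common to all fields of frequency \<open>\<omega>\<close>.\<close>

definition frequency_respecting :: "('d::finite spacetime \<Rightarrow> 'd spacetime) \<Rightarrow> bool" where
  "frequency_respecting M \<longleftrightarrow>
     (\<forall>\<omega>. \<exists>\<omega>'. \<forall>f. time_harmonic \<omega> f \<longrightarrow> time_harmonic \<omega>' (pullback M f))"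

text \<open>The linear map with block matrix \<open>(p, q\<^sup>T; r, S)\<close>.\<close>

definition block_map :: "real \<Rightarrow> real^'d \<Rightarrow> real^'d \<Rightarrow> real^'d^'d
    \<Rightarrow> 'd::finite spacetime \<Rightarrow> 'd spacetime" where
  "block_map p q r S = (\<lambda>(t, x). (p * t + q \<bullet> x, t *\<^sub>R r + S *v x))"

definition Gf_set :: "('d::finite spacetime \<Rightarrow> 'd spacetime) set" where
  "Gf_set = {block_map p q 0 S | p q S. p \<noteq> 0 \<and> invertible S}"

definition Gf :: "('d::finite spacetime \<Rightarrow> 'd spacetime) monoid" where
  "Gf = \<lparr>carrier = Gf_set, mult = (\<circ>), one = id\<rparr>"

end

theory Submission
  imports Defs
begin

text \<open>The profile at frequency \<open>0\<close> that is \<open>1\<close> at the spatial origin and \<open>0\<close> elsewhere already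
  detects the block form. Its pullback is the indicator of the image under \<open>M\<close> of the time axis, and
  the zero set of a time-harmonic field is invariant under time translations whatever its frequency.
  Hence \<open>M\<close> maps the time axis to itself, that is, the spatial rows of \<open>M\<close> have no time component.\<close>

lemma linear_block_map: "linear (block_map p q r S)"
  by (rule linearI)
    (auto simp: block_map_def algebra_simps inner_add_right matrix_vector_right_distrib
      matrix_vector_mult_scaleR)

lemma block_map_time_axis: "block_map p q r S (t, 0) = (p * t, t *\<^sub>R r)"
  by (simp add: block_map_def)

text \<open>Expansion in the standard basis; this supplies the row \<open>q\<close> of a block
  matrix.\<close>

lemma linear_functional_eq_inner:
  fixes f :: "real^'n \<Rightarrow> real"
  assumes "linear f"
  shows "f x = (\<chi> i. f (axis i 1)) \<bullet> x"
proof -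
  have "f x = f (\<Sum>i\<in>UNIV. x $ i *\<^sub>R axis i 1)"
    by (simp add: basis_expansion flip: scalar_mult_eq_scaleR)
  also have "\<dots> = (\<Sum>i\<in>UNIV. x $ i * f (axis i 1))"
    by (simp add: linear_sum[OF assms] linear_cmul[OF assms])
  finally show ?thesis
    by (simp add: inner_vec_def mult.commute)
qed

text \<open>By linearity \<open>M\<close> is determined by its value at \<open>(1, 0)\<close>, whose
  components give \<open>p\<close> and \<open>r\<close>, and by its restriction to the slice of time
  zero, whose components give \<open>q\<close> and \<open>S\<close>.\<close>

lemma linear_eq_block_map:
  fixes M :: "'d::finite spacetime \<Rightarrow> 'd spacetime"
  assumes M: "linear M"
  obtains p q r S where "M = block_map p q r S"
proof -
  have space: "linear (\<lambda>x. M (0, x))"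
    by (rule linear_compose[OF _ M, unfolded o_def]) (auto intro: linearI)
  have "linear (\<lambda>x. fst (M (0, x)))"
    using linear_compose[OF space linear_fst] by (simp add: o_def)
  from linear_functional_eq_inner[OF this]
  have q: "fst (M (0, x)) = (\<chi> i. fst (M (0, axis i 1))) \<bullet> x" for x .
  have "linear (\<lambda>x. snd (M (0, x)))"
    using linear_compose[OF space linear_snd] by (simp add: o_def)
  hence S: "matrix (\<lambda>x. snd (M (0, x))) *v x = snd (M (0, x))" for x
    by (rule fun_cong[OF matrix_vector_mul(2)])
  have D: "M (t, x) = t *\<^sub>R M (1, 0) + M (0, x)" for t x
    by (simp flip: linear_add[OF M] linear_cmul[OF M])
  define N where "N = block_map (fst (M (1, 0))) (\<chi> i. fst (M (0, axis i 1))) (snd (M (1, 0)))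
      (matrix (\<lambda>x. snd (M (0, x))))"
  have "M (t, x) = N (t, x)" for t x
    \<comment> \<open>A single substitution, since the right-hand side of \<open>D\<close> contains
      further instances of its left-hand side.\<close>
    by (subst D) (simp add: N_def block_map_def S prod_eq_iff mult.commute flip: q)
  hence "M = N"
    by auto
  thus ?thesis
    using that by (simp add: N_def)
qed

text \<open>Block matrix multiplication. The upper right block is a row vector stored as a column,
  hence the transpose of \<open>S'\<close>.\<close>

lemma block_map_compose:
  "block_map p q 0 S \<circ> block_map p' q' 0 S'
    = block_map (p * p') (p *\<^sub>R q' + transpose S' *v q) 0 (S ** S')"
proof -
  have "q \<bullet> (S' *v x) = (transpose S' *v q) \<bullet> x" for x
    by (simp add: dot_lmul_matrix)
  thus ?thesis
    by (auto simp: block_map_def fun_eq_iff inner_add_left matrix_vector_mul_assoc algebra_simps)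
qed

lemma block_map_one: "block_map 1 0 0 (mat 1) = id"
  by (auto simp: block_map_def fun_eq_iff)

lemma block_map_inverse:
  fixes S :: "real^'d^'d"
  assumes "p \<noteq> 0" "invertible S"
  obtains q' T where "invertible T"
    "block_map (1 / p) q' 0 T \<circ> block_map p q 0 S = id"
    "block_map p q 0 S \<circ> block_map (1 / p) q' 0 T = id"
proof -
  obtain T where T: "S ** T = mat 1" "T ** S = mat 1"
    using assms(2) unfolding invertible_def by blast
  \<comment> \<open>Solves \<open>p *\<^sub>R q' + transpose T *v q = 0\<close>, the vanishing of
    the upper right block when the candidate inverse is applied first.\<close>
  define q' where "q' = (- 1 / p) *\<^sub>R (transpose T *v q)"
  have "transpose S *v (transpose T *v q) = q"
    by (simp add: T vector_matrix_mul_assoc)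
  hence "transpose S *v q' = (- 1 / p) *\<^sub>R q"
    by (simp only: q'_def matrix_vector_mult_scaleR)
  hence 1: "(1 / p) *\<^sub>R q + transpose S *v q' = 0"
    by (simp del: transpose_matrix_vector)
  have 2: "p *\<^sub>R q' + transpose T *v q = 0"
    using assms(1) by (simp add: q'_def)
  show ?thesis
  proof (rule that)
    show "invertible T"
      using T unfolding invertible_def by blast
    show "block_map (1 / p) q' 0 T \<circ> block_map p q 0 S = id"
      using assms(1) T 1 by (simp only: block_map_compose) (simp add: block_map_one)
    show "block_map p q 0 S \<circ> block_map (1 / p) q' 0 T = id"
      using assms(1) T 2 by (simp only: block_map_compose) (simp add: block_map_one)
  qed
qed

lemma invertible_linear_block_map_iff:
  "invertible_linear (block_map p q 0 S) \<longleftrightarrow> p \<noteq> 0 \<and> invertible S"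
proof
  assume "invertible_linear (block_map p q 0 S)"
  hence bij: "bij (block_map p q 0 S)"
    by (simp add: invertible_linear_def)
  have "p \<noteq> 0"
  proof
    assume "p = 0"
    hence "block_map p q 0 S (1, 0) = block_map p q 0 S (0, 0)"
      by (simp add: block_map_time_axis)
    thus False
      using bij by (auto dest!: injD[OF bij_is_inj])
  qed
  \<comment> \<open>As \<open>r = 0\<close>, the spatial part of an image depends on
    \<open>x\<close> alone, so a preimage of \<open>(0, y)\<close> contains a solution of
    \<open>S *v x = y\<close>.\<close>
  moreover have "surj ((*v) S)"
    unfolding surj_def
  proof
    fix y
    obtain t x where "block_map p q 0 S (t, x) = (0, y)"
      using bij by (metis bij_pointE surj_pair)
    thus "\<exists>x. y = S *v x"
      by (auto simp: block_map_def)
  qed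
  hence "invertible S"
    by (metis invertible_def matrix_left_right_inverse matrix_right_invertible_surjective)
  ultimately show "p \<noteq> 0 \<and> invertible S" ..
next
  assume "p \<noteq> 0 \<and> invertible S"
  then obtain q' T where "block_map (1 / p) q' 0 T \<circ> block_map p q 0 S = id"
    "block_map p q 0 S \<circ> block_map (1 / p) q' 0 T = id"
    using block_map_inverse by blast
  thus "invertible_linear (block_map p q 0 S)"
    by (auto simp: invertible_linear_def linear_block_map intro: o_bij)
qed

lemma pullback_block_map_time_harmonic:
  assumes "p \<noteq> 0" "invertible S" "time_harmonic \<omega> f"
  shows "time_harmonic (\<omega> / p) (pullback (block_map p q 0 S) f)"
proof -
  obtain q' T where inv: "block_map (1 / p) q' 0 T \<circ> block_map p q 0 S = id"
    "block_map p q 0 S \<circ> block_map (1 / p) q' 0 T = id"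
    using block_map_inverse[OF assms(1,2)] by blast
  have N: "inv_into UNIV (block_map p q 0 S) = block_map (1 / p) q' 0 T"
    using inv by (intro inv_equality) (metis comp_apply id_apply)+
  obtain F where F: "\<And>t x. f (t, x) = exp (- \<i> * of_real \<omega> * of_real t) * F x"
    using assms(3) unfolding time_harmonic_def by blast
  have "pullback (block_map p q 0 S) f = f \<circ> block_map (1 / p) q' 0 T"
    by (simp add: pullback_def N)
  \<comment> \<open>The inverse sends \<open>(t, x)\<close> to
    \<open>(t / p + q' \<bullet> x, T *v x)\<close>. The phase splits: the part from
    \<open>q' \<bullet> x\<close> is independent of \<open>t\<close> and joins the new
    profile.\<close>
  hence "pullback (block_map p q 0 S) f (t, x) = exp (- \<i> * of_real (\<omega> / p) * of_real t)
      * (exp (- \<i> * of_real \<omega> * of_real (q' \<bullet> x)) * F (T *v x))" for t x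
    by (simp add: block_map_def F algebra_simps flip: exp_add)
  thus ?thesis
    unfolding time_harmonic_def by (intro exI allI)
qed

lemma frequency_respecting_time_axis:
  assumes M: "invertible_linear M" and "frequency_respecting M"
  shows "snd (M (1, 0)) = 0"
proof -
  have lin: "linear M" and bij: "bij M"
    using M by (auto simp: invertible_linear_def)
  define N where "N = inv_into UNIV M"
  have MN: "M (N \<xi>) = \<xi>" for \<xi>
    using bij by (simp add: N_def bij_is_surj surj_f_inv_f)
  have N0: "N 0 = 0"
    using bij linear_0[OF lin] by (metis MN bij_is_inj injD)
  define f :: "real \<times> (real^'a) \<Rightarrow> complex" where "f = (\<lambda>(t, x). if x = 0 then 1 else 0)"
  have "time_harmonic 0 f"
    by (auto simp: time_harmonic_def f_def intro: exI[of _ "\<lambda>x. if x = 0 then 1 else 0"])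
  then obtain \<omega>' where "time_harmonic \<omega>' (f \<circ> N)"
    using assms(2) by (auto simp: frequency_respecting_def pullback_def N_def)
  then obtain G where G: "\<And>t x. f (N (t, x)) = exp (- \<i> * of_real \<omega>' * of_real t) * G x"
    by (auto simp: time_harmonic_def)
  \<comment> \<open>The origin is fixed by \<open>N\<close> and \<open>f\<close> is \<open>1\<close>
    there. As exponentials never vanish, \<open>f\<close> is then nonzero at the preimage of every
    point of the time axis.\<close>
  have "G 0 \<noteq> 0"
    using G[of 0 0] N0 by (auto simp: f_def zero_prod_def)
  hence "f (N (1, 0)) \<noteq> 0"
    by (simp add: G)
  then obtain a where a: "N (1, 0) = (a, 0)"
    by (cases "N (1, 0)") (auto simp: f_def split: if_splits)
  \<comment> \<open>The time component forces \<open>a\<close> to be nonzero, so the spatial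
    component of \<open>M (1, 0)\<close> vanishes.\<close>
  have "(1, 0) = a *\<^sub>R M (1, 0)"
    using MN[of "(1, 0)"] by (simp add: a flip: linear_cmul[OF lin])
  thus ?thesis
    by (auto simp: prod_eq_iff)
qed

lemma frequency_respecting_iff:
  assumes "invertible_linear M"
  shows "frequency_respecting M \<longleftrightarrow>
    (\<exists>p q S. p \<noteq> 0 \<and> invertible S \<and> M = block_map p q 0 S)"
proof
  assume fr: "frequency_respecting M"
  obtain p q r S where M: "M = block_map p q r S"
    using assms linear_eq_block_map unfolding invertible_linear_def by blast
  have "r = 0"
    using frequency_respecting_time_axis[OF assms fr] by (simp add: M block_map_time_axis)
  thus "\<exists>p q S. p \<noteq> 0 \<and> invertible S \<and> M = block_map p q 0 S"
    using assms M by (metis invertible_linear_block_map_iff)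
next
  assume "\<exists>p q S. p \<noteq> 0 \<and> invertible S \<and> M = block_map p q 0 S"
  \<comment> \<open>The new frequency \<open>\<omega> / p\<close> is the same for all fields of
    frequency \<open>\<omega>\<close>, as the quantifier order demands.\<close>
  thus "frequency_respecting M"
    unfolding frequency_respecting_def using pullback_block_map_time_harmonic by blast
qed

lemma block_map_in_Gf_set: "p \<noteq> 0 \<Longrightarrow> invertible S \<Longrightarrow> block_map p q 0 S \<in> Gf_set"
  unfolding Gf_set_def by blast

text \<open>The block \<open>r\<close> can be read off from the map as the spatial part of the image
  of \<open>(1, 0)\<close>, so it does not depend on the chosen representation.\<close>

lemma block_map_mem_Gf_set_iff:
  assumes "invertible_linear (block_map p q r S)"
  shows "block_map p q r S \<in> Gf_set \<longleftrightarrow> r = 0"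
proof
  assume "block_map p q r S \<in> Gf_set"
  then obtain p' q' S' where "block_map p q r S = block_map p' q' 0 S'"
    by (auto simp: Gf_set_def)
  hence "block_map p q r S (1, 0) = block_map p' q' 0 S' (1, 0)"
    by simp
  thus "r = 0"
    by (simp add: block_map_time_axis)
next
  assume "r = 0"
  thus "block_map p q r S \<in> Gf_set"
    using assms by (simp add: invertible_linear_block_map_iff block_map_in_Gf_set)
qed

lemma group_Gf: "group (Gf :: ('d::finite spacetime \<Rightarrow> 'd spacetime) monoid)"
proof (rule groupI)
  fix M N :: "'d spacetime \<Rightarrow> 'd spacetime"
  assume "M \<in> carrier Gf" "N \<in> carrier Gf"
  thus "M \<otimes>\<^bsub>Gf\<^esub> N \<in> carrier Gf"
    by (fastforce simp: Gf_def Gf_set_def block_map_compose intro: invertible_mult)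
next
  show "\<one>\<^bsub>Gf\<^esub> \<in> carrier (Gf :: ('d spacetime \<Rightarrow> 'd spacetime) monoid)"
  proof -
    have "invertible (mat 1 :: real^'d^'d)"
      unfolding invertible_def by (metis matrix_mul_lid)
    thus ?thesis
      \<comment> \<open>The identity is rewritten as a block map, so that membership reduces to
        conditions on its blocks.\<close>
      by (simp add: Gf_def block_map_in_Gf_set flip: block_map_one)
  qed
next
  fix M :: "'d spacetime \<Rightarrow> 'd spacetime"
  assume "M \<in> carrier Gf"
  then obtain p q S where M: "p \<noteq> 0" "invertible S" "M = block_map p q 0 S"
    by (auto simp: Gf_def Gf_set_def)
  obtain q' T where "invertible T" "block_map (1 / p) q' 0 T \<circ> M = id"
    using block_map_inverse[OF M(1,2)] M(3) by metis
  moreover have "1 / p \<noteq> 0"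
    using M(1) by simp
  ultimately show "\<exists>N\<in>carrier Gf. N \<otimes>\<^bsub>Gf\<^esub> M = \<one>\<^bsub>Gf\<^esub>"
    by (intro bexI[of _ "block_map (1 / p) q' 0 T"]) (simp_all add: Gf_def block_map_in_Gf_set)
qed (simp_all add: Gf_def comp_assoc)

text \<open>The second conjunct makes precise that the spatial rows contain no time component; the
  fourth places the group inside the invertible linear maps.\<close>

theorem lemma7:
  assumes "CARD('d::finite) \<in> {2, 3}"
  shows "(\<forall>M :: 'd spacetime \<Rightarrow> 'd spacetime. invertible_linear M \<longrightarrow>
           (frequency_respecting M \<longleftrightarrow>
             (\<exists>p q S. p \<noteq> 0 \<and> invertible S \<and> M = block_map p q 0 S)))
       \<and> (\<forall>p (q :: real^'d) r S. invertible_linear (block_map p q r S) \<longrightarrow>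
           (block_map p q r S \<in> Gf_set \<longleftrightarrow> r = 0))
       \<and> (\<forall>p (q :: real^'d) S \<omega> f. p \<noteq> 0 \<and> invertible S \<and> time_harmonic \<omega> f \<longrightarrow>
           time_harmonic (\<omega> / p) (pullback (block_map p q 0 S) f))
       \<and> (Gf_set :: ('d spacetime \<Rightarrow> 'd spacetime) set) \<subseteq> Collect invertible_linear
       \<and> group (Gf :: ('d spacetime \<Rightarrow> 'd spacetime) monoid)"
proof (intro conjI)
  show "(Gf_set :: ('d spacetime \<Rightarrow> 'd spacetime) set) \<subseteq> Collect invertible_linear"
    by (auto simp: Gf_set_def invertible_linear_block_map_iff)
qed (simp_all add: frequency_respecting_iff block_map_mem_Gf_set_iff
    pullback_block_map_time_harmonic group_Gf)

end
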